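(* Let $R$ be a commutative ring with $1\neq 0$ and let $M$ be a nonzero unital $R$-module that is a multiplication module and meet irreducible. Let $\mathfrak{B}_M$ be the family of all cosets $m+N$ where $m\in M$ and $N$ is a nonzero submodule of $M$ with $N+Rm=M$. Then $\mathfrak{B}_M$ is a basis for a topology on $M$ (denoted $\widetilde{G(M)}$).
   Context: An $R$-module $M$ is a multiplication module if every submodule $N$ of $M$ has the form $N=IM$ for some ideal $I$ of $R$. An $R$-module $M$ is meet irreducible if the intersection of any two nonzero submodules of $M$ is nonzero. *)

theory Defs
  imports "HOL-Algebra.Ideal" "HOL-Algebra.Module" "HOL-Analysis.Abstract_Topology"
begin

(* I M: the finite sums of elements i m, in the style of ideal_prod. If I is an ideal,
   this is a submodule: it contains the zero vector as a product. *)
inductive_set ideal_smult ::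
    "('a, 'r) ring_scheme \<Rightarrow> ('a, 'b, 'm) module_scheme \<Rightarrow> 'a set \<Rightarrow> 'b set"
  for R and M and I where
    smult: "\<lbrakk> i \<in> I; x \<in> carrier M \<rbrakk> \<Longrightarrow> i \<odot>\<^bsub>M\<^esub> x \<in> ideal_smult R M I"
  | add: "\<lbrakk> x \<in> ideal_smult R M I; y \<in> ideal_smult R M I \<rbrakk>
            \<Longrightarrow> x \<oplus>\<^bsub>M\<^esub> y \<in> ideal_smult R M I"

definition multiplication_module ::
    "('a, 'r) ring_scheme \<Rightarrow> ('a, 'b, 'm) module_scheme \<Rightarrow> bool" where
  "multiplication_module R M \<longleftrightarrow>
     (\<forall>N. submodule N R M \<longrightarrow> (\<exists>I. ideal I R \<and> N = ideal_smult R M I))"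

definition meet_irreducible ::
    "('a, 'r) ring_scheme \<Rightarrow> ('a, 'b, 'm) module_scheme \<Rightarrow> bool" where
  "meet_irreducible R M \<longleftrightarrow>
     (\<forall>N L. submodule N R M \<and> N \<noteq> {\<zero>\<^bsub>M\<^esub>} \<and> submodule L R M \<and> L \<noteq> {\<zero>\<^bsub>M\<^esub>}
        \<longrightarrow> N \<inter> L \<noteq> {\<zero>\<^bsub>M\<^esub>})"

definition cyclic_submodule ::
    "('a, 'r) ring_scheme \<Rightarrow> ('a, 'b, 'm) module_scheme \<Rightarrow> 'b \<Rightarrow> 'b set" where
  "cyclic_submodule R M m = (\<lambda>r. r \<odot>\<^bsub>M\<^esub> m) ` carrier R"

definition coset_basis ::
    "('a, 'r) ring_scheme \<Rightarrow> ('a, 'b, 'm) module_scheme \<Rightarrow> 'b set set" where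
  "coset_basis R M =
     {m <+\<^bsub>M\<^esub> N | m N. m \<in> carrier M \<and> submodule N R M \<and> N \<noteq> {\<zero>\<^bsub>M\<^esub>} \<and>
        N <+>\<^bsub>M\<^esub> cyclic_submodule R M m = carrier M}"

(* The constructor topology is unspecified on predicates that are not topologies, so
   that openin gives back the unions of basis sets is a genuine claim. *)
definition G_tilde ::
    "('a, 'r) ring_scheme \<Rightarrow> ('a, 'b, 'm) module_scheme \<Rightarrow> 'b topology" where
  "G_tilde R M = topology (arbitrary union_of (\<lambda>U. U \<in> coset_basis R M))"

end

theory Submission
  imports Defs
begin

text \<open>
  By the standard criterion, a family of sets consists of the basic open sets of a topology
  once every nonempty intersection of two members is a union of members. So let \<open>x\<close> lie in
  both \<open>m + N\<close> and \<open>l + L\<close>. Either coset may be re-based at \<open>x\<close> without disturbing the side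
  condition: it says that the representative generates \<open>M\<close> modulo the submodule, and \<open>x\<close> is
  congruent to \<open>m\<close> modulo \<open>N\<close> and to \<open>l\<close> modulo \<open>L\<close>. The
  intersection is then the single coset \<open>x + (N \<inter> L)\<close>, and meet irreducibility makes \<open>N \<inter> L\<close>
  nonzero.

  What remains is \<open>(N \<inter> L) + R x = M\<close>. In a general module two submodules may each be
  comaximal with \<open>R x\<close> while their intersection is not; in a multiplication module \<open>N = I M\<close>
  for an ideal \<open>I\<close>, and the usual argument for ideals applies:
  \<open>N = I M = I (L + R x) \<subseteq> I L + R x \<subseteq> (N \<inter> L) + R x\<close>, so that
  \<open>M = N + R x\<close> is contained in \<open>(N \<inter> L) + R x\<close>. This is
  \<open>comaximal_Int_ideal_smult\<close> below. Finally, the basic sets cover \<open>M\<close>, because \<open>M\<close> itself is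
  the coset \<open>0 + M\<close>.
\<close>

section \<open>Sums and intersections of submodules\<close>

context Module.module
begin

lemma submodule_Int:
  assumes "submodule N R M" and "submodule L R M"
  shows "submodule (N \<inter> L) R M"
  using submoduleE[OF assms(1)] submoduleE[OF assms(2)]
    subgroup.one_closed[OF submodule.axioms(1)[OF assms(1)]]
    subgroup.one_closed[OF submodule.axioms(1)[OF assms(2)]]
  by (intro submoduleI) auto

lemma set_add_closed:
  assumes N: "submodule N R M" and K: "submodule K R M"
    and x: "x \<in> N <+>\<^bsub>M\<^esub> K" and y: "y \<in> N <+>\<^bsub>M\<^esub> K"
  shows "x \<oplus>\<^bsub>M\<^esub> y \<in> N <+>\<^bsub>M\<^esub> K"
proof -
  obtain a b c d where *: "a \<in> N" "b \<in> K" "x = a \<oplus>\<^bsub>M\<^esub> b" "c \<in> N" "d \<in> K" "y = c \<oplus>\<^bsub>M\<^esub> d"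
    using x y by (auto simp: set_add_def')
  moreover have "a \<in> carrier M" "b \<in> carrier M" "c \<in> carrier M" "d \<in> carrier M"
    using * submoduleE(1)[OF N] submoduleE(1)[OF K] by auto
  ultimately have "x \<oplus>\<^bsub>M\<^esub> y = (a \<oplus>\<^bsub>M\<^esub> c) \<oplus>\<^bsub>M\<^esub> (b \<oplus>\<^bsub>M\<^esub> d)"
    by (simp add: M.a_ac)
  moreover have "a \<oplus>\<^bsub>M\<^esub> c \<in> N" "b \<oplus>\<^bsub>M\<^esub> d \<in> K"
    using * submoduleE(5)[OF N] submoduleE(5)[OF K] by auto
  ultimately show ?thesis
    unfolding set_add_def' by blast
qed

lemma set_add_superset_right:
  assumes N: "submodule N R M" and K: "submodule K R M"
  shows "K \<subseteq> N <+>\<^bsub>M\<^esub> K"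
proof
  fix k assume "k \<in> K"
  moreover have "\<zero>\<^bsub>M\<^esub> \<in> N"
    using subgroup.one_closed[OF submodule.axioms(1)[OF N]] by simp
  moreover have "k = \<zero>\<^bsub>M\<^esub> \<oplus>\<^bsub>M\<^esub> k"
    using \<open>k \<in> K\<close> submoduleE(1)[OF K] by auto
  ultimately show "k \<in> N <+>\<^bsub>M\<^esub> K"
    unfolding set_add_def' by blast
qed

lemma set_add_superset_left:
  assumes N: "submodule N R M" and K: "submodule K R M"
  shows "N \<subseteq> N <+>\<^bsub>M\<^esub> K"
proof
  fix n assume "n \<in> N"
  moreover have "\<zero>\<^bsub>M\<^esub> \<in> K"
    using subgroup.one_closed[OF submodule.axioms(1)[OF K]] by simp
  moreover have "n = n \<oplus>\<^bsub>M\<^esub> \<zero>\<^bsub>M\<^esub>"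
    using \<open>n \<in> N\<close> submoduleE(1)[OF N] by auto
  ultimately show "n \<in> N <+>\<^bsub>M\<^esub> K"
    unfolding set_add_def' by blast
qed

text \<open>
  Multiplying \<open>L + K = M\<close> by \<open>I\<close> gives \<open>I M \<subseteq> I L + K\<close>, and \<open>I L\<close> lies both in \<open>L\<close> and in
  \<open>I M\<close>. The induction follows the generation of \<open>I M\<close> by products and sums.
\<close>

lemma ideal_smult_subset_set_add_Int:
  assumes I: "I \<subseteq> carrier R" and IM: "submodule (ideal_smult R M I) R M"
    and L: "submodule L R M" and K: "submodule K R M"
    and LK: "L <+>\<^bsub>M\<^esub> K = carrier M"
  shows "ideal_smult R M I \<subseteq> (ideal_smult R M I \<inter> L) <+>\<^bsub>M\<^esub> K"
proof
  fix y assume "y \<in> ideal_smult R M I"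
  then show "y \<in> (ideal_smult R M I \<inter> L) <+>\<^bsub>M\<^esub> K"
  proof induction
    case (smult i x)
    obtain l k where lk: "l \<in> L" "k \<in> K" "x = l \<oplus>\<^bsub>M\<^esub> k"
      using smult.hyps(2) unfolding LK[symmetric] set_add_def' by auto
    have mem: "i \<in> carrier R" "l \<in> carrier M" "k \<in> carrier M"
      using smult.hyps I lk submoduleE(1)[OF L] submoduleE(1)[OF K] by auto
    have "i \<odot>\<^bsub>M\<^esub> x = i \<odot>\<^bsub>M\<^esub> l \<oplus>\<^bsub>M\<^esub> i \<odot>\<^bsub>M\<^esub> k"
      using mem lk by (simp add: smult_r_distr)
    moreover have "i \<odot>\<^bsub>M\<^esub> l \<in> ideal_smult R M I \<inter> L" "i \<odot>\<^bsub>M\<^esub> k \<in> K"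
      using smult.hyps mem lk submoduleE(4)[OF L] submoduleE(4)[OF K]
      by (auto intro: ideal_smult.smult)
    ultimately show ?case
      unfolding set_add_def' by blast
  next
    case (add x y)
    then show ?case
      by (intro set_add_closed[OF submodule_Int[OF IM L] K])
  qed
qed

lemma comaximal_Int_ideal_smult:
  assumes I: "I \<subseteq> carrier R" and IM: "submodule (ideal_smult R M I) R M"
    and L: "submodule L R M" and K: "submodule K R M"
    and IK: "ideal_smult R M I <+>\<^bsub>M\<^esub> K = carrier M" and LK: "L <+>\<^bsub>M\<^esub> K = carrier M"
  shows "(ideal_smult R M I \<inter> L) <+>\<^bsub>M\<^esub> K = carrier M"
proof
  note Int = submodule_Int[OF IM L]
  show "(ideal_smult R M I \<inter> L) <+>\<^bsub>M\<^esub> K \<subseteq> carrier M"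
    by (intro M.setadd_subset_G submoduleE(1)[OF Int] submoduleE(1)[OF K])
  show "carrier M \<subseteq> (ideal_smult R M I \<inter> L) <+>\<^bsub>M\<^esub> K"
  proof
    fix y assume "y \<in> carrier M"
    then obtain n k where "n \<in> ideal_smult R M I" "k \<in> K" "y = n \<oplus>\<^bsub>M\<^esub> k"
      unfolding IK[symmetric] set_add_def' by auto
    then show "y \<in> (ideal_smult R M I \<inter> L) <+>\<^bsub>M\<^esub> K"
      using ideal_smult_subset_set_add_Int[OF I IM L K LK] set_add_superset_right[OF Int K]
        set_add_closed[OF Int K] by blast
  qed
qed

section \<open>Cosets and their representatives\<close>

lemma submodule_cyclic:
  assumes m: "m \<in> carrier M"
  shows "submodule (cyclic_submodule R M m) R M"
proof (rule submoduleI)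
  show "cyclic_submodule R M m \<subseteq> carrier M"
    using m by (auto simp: cyclic_submodule_def)
  show "\<zero>\<^bsub>M\<^esub> \<in> cyclic_submodule R M m"
    using m by (auto simp: cyclic_submodule_def intro!: image_eqI[where x = "\<zero>"])
next
  fix a assume "a \<in> cyclic_submodule R M m"
  then show "\<ominus>\<^bsub>M\<^esub> a \<in> cyclic_submodule R M m"
    using m by (auto simp: cyclic_submodule_def smult_l_minus[symmetric])
next
  fix a b assume "a \<in> cyclic_submodule R M m" "b \<in> cyclic_submodule R M m"
  then show "a \<oplus>\<^bsub>M\<^esub> b \<in> cyclic_submodule R M m"
    using m by (auto simp: cyclic_submodule_def smult_l_distr[symmetric])
next
  fix a x assume "a \<in> carrier R" "x \<in> cyclic_submodule R M m"
  then show "a \<odot>\<^bsub>M\<^esub> x \<in> cyclic_submodule R M m"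
    using m by (auto simp: cyclic_submodule_def smult_assoc1[symmetric])
qed

text \<open>
  Both sums below are preimages of the cyclic submodule that \<open>m\<close>, respectively \<open>x\<close>, generates
  in \<open>M / N\<close>, where the two elements coincide. Elementwise, the multiple \<open>r m\<close> is
  \<open>r x - r n\<close> if \<open>x = m + n\<close>.
\<close>

lemma set_add_cyclic_rebase:
  assumes x: "x \<in> m <+\<^bsub>M\<^esub> N" and m: "m \<in> carrier M" and N: "submodule N R M"
    and gen: "N <+>\<^bsub>M\<^esub> cyclic_submodule R M m = carrier M"
  shows "N <+>\<^bsub>M\<^esub> cyclic_submodule R M x = carrier M"
proof
  obtain n where n: "n \<in> N" "x = m \<oplus>\<^bsub>M\<^esub> n"
    using x by (auto simp: a_l_coset_def')
  have nM: "n \<in> carrier M" and xM: "x \<in> carrier M"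
    using n m submoduleE(1)[OF N] by auto
  show "N <+>\<^bsub>M\<^esub> cyclic_submodule R M x \<subseteq> carrier M"
    by (intro M.setadd_subset_G submoduleE(1)[OF N] submoduleE(1)[OF submodule_cyclic[OF xM]])
  show "carrier M \<subseteq> N <+>\<^bsub>M\<^esub> cyclic_submodule R M x"
  proof
    fix y assume "y \<in> carrier M"
    then obtain a r where a: "a \<in> N" and r: "r \<in> carrier R" and y: "y = a \<oplus>\<^bsub>M\<^esub> r \<odot>\<^bsub>M\<^esub> m"
      unfolding gen[symmetric] set_add_def' cyclic_submodule_def by auto
    have aM: "a \<in> carrier M"
      using a submoduleE(1)[OF N] by auto
    have "r \<odot>\<^bsub>M\<^esub> x = r \<odot>\<^bsub>M\<^esub> m \<oplus>\<^bsub>M\<^esub> r \<odot>\<^bsub>M\<^esub> n"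
      using n r m nM by (simp add: smult_r_distr)
    then have "r \<odot>\<^bsub>M\<^esub> m = \<ominus>\<^bsub>M\<^esub> (r \<odot>\<^bsub>M\<^esub> n) \<oplus>\<^bsub>M\<^esub> r \<odot>\<^bsub>M\<^esub> x"
      using r m nM M.a_comm[of "r \<odot>\<^bsub>M\<^esub> m" "r \<odot>\<^bsub>M\<^esub> n"] by (simp add: M.r_neg1)
    then have "y = (a \<oplus>\<^bsub>M\<^esub> \<ominus>\<^bsub>M\<^esub> (r \<odot>\<^bsub>M\<^esub> n)) \<oplus>\<^bsub>M\<^esub> r \<odot>\<^bsub>M\<^esub> x"
      using y aM r nM xM by (simp add: M.a_assoc)
    moreover have "a \<oplus>\<^bsub>M\<^esub> \<ominus>\<^bsub>M\<^esub> (r \<odot>\<^bsub>M\<^esub> n) \<in> N"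
      using a r n by (intro submoduleE(3-5)[OF N])
    ultimately show "y \<in> N <+>\<^bsub>M\<^esub> cyclic_submodule R M x"
      using r unfolding set_add_def' cyclic_submodule_def by blast
  qed
qed

lemma a_l_coset_Int:
  assumes x: "x \<in> carrier M" and N: "submodule N R M" and L: "submodule L R M"
  shows "(x <+\<^bsub>M\<^esub> N) \<inter> (x <+\<^bsub>M\<^esub> L) = x <+\<^bsub>M\<^esub> (N \<inter> L)"
proof -
  have "n = l" if "n \<in> N" "l \<in> L" "x \<oplus>\<^bsub>M\<^esub> n = x \<oplus>\<^bsub>M\<^esub> l" for n l
    using that x submoduleE(1)[OF N] submoduleE(1)[OF L] by (simp add: subset_iff)
  then show ?thesis
    by (auto simp: a_l_coset_def')
qed

section \<open>The basis\<close>

lemma coset_basis_rebase: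
  assumes "U \<in> coset_basis R M" and "x \<in> U"
  obtains N where "submodule N R M" "N \<noteq> {\<zero>\<^bsub>M\<^esub>}" "U = x <+\<^bsub>M\<^esub> N"
    "N <+>\<^bsub>M\<^esub> cyclic_submodule R M x = carrier M" "x \<in> carrier M"
proof -
  obtain m N where *: "U = m <+\<^bsub>M\<^esub> N" "m \<in> carrier M" "submodule N R M" "N \<noteq> {\<zero>\<^bsub>M\<^esub>}"
    "N <+>\<^bsub>M\<^esub> cyclic_submodule R M m = carrier M"
    using assms(1) by (auto simp: coset_basis_def)
  have "x \<in> carrier M"
    using assms(2) * submoduleE(1)[OF *(3)] by (auto simp: a_l_coset_def')
  then show thesis
    using that[of N] * assms(2) set_add_cyclic_rebase[of x m N]
      M.a_l_repr_independence[of x m N] submodule.axioms(1)[OF *(3)] by simp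
qed

lemma coset_basis_Int:
  assumes mult: "multiplication_module R M" and meet: "meet_irreducible R M"
    and U: "U \<in> coset_basis R M" and V: "V \<in> coset_basis R M" and x: "x \<in> U \<inter> V"
  shows "U \<inter> V \<in> coset_basis R M"
proof -
  obtain N where N: "submodule N R M" "N \<noteq> {\<zero>\<^bsub>M\<^esub>}" "U = x <+\<^bsub>M\<^esub> N"
    "N <+>\<^bsub>M\<^esub> cyclic_submodule R M x = carrier M" and xM: "x \<in> carrier M"
    using coset_basis_rebase[OF U] x by blast
  obtain L where L: "submodule L R M" "L \<noteq> {\<zero>\<^bsub>M\<^esub>}" "V = x <+\<^bsub>M\<^esub> L"
    "L <+>\<^bsub>M\<^esub> cyclic_submodule R M x = carrier M"
    using coset_basis_rebase[OF V] x by blast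
  obtain I where I: "ideal I R" "N = ideal_smult R M I"
    using mult N(1) by (auto simp: multiplication_module_def)
  have "I \<subseteq> carrier R"
    using additive_subgroup.a_subset[OF ideal.axioms(1)[OF I(1)]] .
  then have "(N \<inter> L) <+>\<^bsub>M\<^esub> cyclic_submodule R M x = carrier M"
    using comaximal_Int_ideal_smult[of I L "cyclic_submodule R M x"] submodule_cyclic[OF xM] N L I
    by blast
  moreover have "N \<inter> L \<noteq> {\<zero>\<^bsub>M\<^esub>}"
    using meet N(1,2) L(1,2) by (auto simp: meet_irreducible_def)
  moreover have "U \<inter> V = x <+\<^bsub>M\<^esub> (N \<inter> L)"
    using a_l_coset_Int[OF xM N(1) L(1)] N(3) L(3) by simp
  ultimately show ?thesis
    using xM submodule_Int[OF N(1) L(1)] unfolding coset_basis_def by blast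
qed

lemma carrier_in_coset_basis:
  assumes "carrier M \<noteq> {\<zero>\<^bsub>M\<^esub>}"
  shows "carrier M \<in> coset_basis R M"
proof -
  have zero: "submodule (cyclic_submodule R M \<zero>\<^bsub>M\<^esub>) R M"
    by (simp add: submodule_cyclic)
  have "carrier M <+>\<^bsub>M\<^esub> cyclic_submodule R M \<zero>\<^bsub>M\<^esub> = carrier M"
  proof
    show "carrier M <+>\<^bsub>M\<^esub> cyclic_submodule R M \<zero>\<^bsub>M\<^esub> \<subseteq> carrier M"
      by (intro M.setadd_subset_G submoduleE(1)[OF zero] subset_refl)
    show "carrier M \<subseteq> carrier M <+>\<^bsub>M\<^esub> cyclic_submodule R M \<zero>\<^bsub>M\<^esub>"
      using zero set_add_superset_left carrier_is_submodule by blast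
  qed
  moreover have "\<zero>\<^bsub>M\<^esub> <+\<^bsub>M\<^esub> carrier M = carrier M"
    by (rule M.a_lcos_mult_one) simp
  ultimately show ?thesis
    using assms carrier_is_submodule M.zero_closed unfolding coset_basis_def by blast
qed

lemma coset_basis_subset_carrier:
  assumes "U \<in> coset_basis R M"
  shows "U \<subseteq> carrier M"
  using coset_basis_rebase[OF assms] by blast

end

text \<open>
  Two disjoint basic sets meet in the empty union of basic sets, which is why the criterion is
  used in the form that asks for a union.
\<close>

theorem theorem3:
  fixes R :: "('a, 'r) ring_scheme" and M :: "('a, 'b, 'm) module_scheme"
  assumes "Module.module R M"
    and "\<one>\<^bsub>R\<^esub> \<noteq> \<zero>\<^bsub>R\<^esub>"
    and "carrier M \<noteq> {\<zero>\<^bsub>M\<^esub>}"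
    and "multiplication_module R M"
    and "meet_irreducible R M"
  shows "topspace (G_tilde R M) = carrier M \<and>
         openin (G_tilde R M) = arbitrary union_of (\<lambda>U. U \<in> coset_basis R M)"
proof -
  interpret Module.module R M by fact
  have "(arbitrary union_of (\<lambda>U. U \<in> coset_basis R M)) (S \<inter> T)"
    if "S \<in> coset_basis R M" "T \<in> coset_basis R M" for S T
    using coset_basis_Int[OF assms(4,5) that] by (auto simp: arbitrary_union_of_alt)
  then have "istopology (arbitrary union_of (\<lambda>U. U \<in> coset_basis R M))"
    by (simp add: istopology_base_eq)
  then have openin: "openin (G_tilde R M) = arbitrary union_of (\<lambda>U. U \<in> coset_basis R M)"
    unfolding G_tilde_def by (rule topology_inverse')
  moreover have "topspace (G_tilde R M) = carrier M"
  proof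
    show "topspace (G_tilde R M) \<subseteq> carrier M"
      using coset_basis_subset_carrier
      by (fastforce simp: topspace_def openin arbitrary_union_of_alt)
    show "carrier M \<subseteq> topspace (G_tilde R M)"
      using carrier_in_coset_basis[OF assms(3)]
      by (auto intro!: openin_subset simp: openin arbitrary_union_of_alt)
  qed
  ultimately show ?thesis
    by blast
qed

end
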